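(* Let $(X,d)$ be an infinite metric space and let $\mathfrak{B}$ be a bornology on $X$ with a closed base such that $X\notin\mathfrak{B}$. The following statements are equivalent. (1) ONE has a winning strategy in the $\mathfrak{B}^s$-open game $\mathcal{O}_{\mathfrak{B}^s}(X)$. (2) ONE has a winning strategy in the $\gamma_{\mathfrak{B}^s}$-open game $\Gamma_{\mathfrak{B}^s}(X)$.
   Context: A bornology on a set $X$ is a family $\mathfrak{B}$ of subsets of $X$ that covers $X$, is closed under finite unions and is closed under taking subsets. A base of $\mathfrak{B}$ is a subfamily $\mathfrak{B}_0\subseteq\mathfrak{B}$ such that every $B\in\mathfrak{B}$ is contained in some $B_0\in\mathfrak{B}_0$; it is a closed base if all its members are closed in $X$. For $B\subseteq X$ and $\delta>0$, $B^\delta=\bigcup_{x\in B}\{y\in X: d(x,y)<\delta\}$. An open $\mathfrak{B}^s$-cover of $X$ is a family $\mathcal{U}$ of open subsets of $X$ that covers $X$ with $X\notin\mathcal{U}$ such that for every $B\in\mathfrak{B}$ there are $U\in\mathcal{U}$ and $\delta>0$ with $B^\delta\subseteq U$. A $\gamma_{\mathfrak{B}^s}$-cover of $X$ is an open cover $\{U_n:n\in\mathbb{N}\}$, infinite and not containing $X$ as a member, such that for every $B\in\mathfrak{B}$ there are $n_0\in\mathbb{N}$ and positive reals $\delta_n$ ($n\ge n_0$) with $B^{\delta_n}\subseteq U_n$ for all $n\ge n_0$. Both games are played by ONE and TWO in rounds $n\in\mathbb{N}$: in round $n$ ONE chooses $B_n\in\mathfrak{B}$ and TWO responds with an open set $U_n\ne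 X$ such that $B_n^{\delta_n}\subseteq U_n$ for some $\delta_n>0$. In $\mathcal{O}_{\mathfrak{B}^s}(X)$ ONE wins if $\{U_n:n\in\mathbb{N}\}$ is an open $\mathfrak{B}^s$-cover of $X$; in $\Gamma_{\mathfrak{B}^s}(X)$ ONE wins if $\{U_n:n\in\mathbb{N}\}$ is a $\gamma_{\mathfrak{B}^s}$-cover of $X$. Otherwise TWO wins. Strategies are with full memory of the opponent's previous moves. *)

theory Defs
  imports "HOL-Analysis.Analysis"
begin

definition bornology_on :: "'a set \<Rightarrow> 'a set set \<Rightarrow> bool" where
  "bornology_on X \<BB> \<longleftrightarrow>
     \<Union>\<BB> = X \<and>
     (\<forall>\<F>. finite \<F> \<and> \<F> \<subseteq> \<BB> \<longrightarrow> \<Union>\<F> \<in> \<BB>) \<and>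
     (\<forall>B\<in>\<BB>. \<forall>A. A \<subseteq> B \<longrightarrow> A \<in> \<BB>)"

definition bornology_base :: "'a set set \<Rightarrow> 'a set set \<Rightarrow> bool" where
  "bornology_base \<BB> \<BB>\<^sub>0 \<longleftrightarrow> \<BB>\<^sub>0 \<subseteq> \<BB> \<and> (\<forall>B\<in>\<BB>. \<exists>B\<^sub>0\<in>\<BB>\<^sub>0. B \<subseteq> B\<^sub>0)"

context Metric_space
begin

definition closed_bornology_base :: "'a set set \<Rightarrow> 'a set set \<Rightarrow> bool" where
  "closed_bornology_base \<BB> \<BB>\<^sub>0 \<longleftrightarrow>
     bornology_base \<BB> \<BB>\<^sub>0 \<and> (\<forall>C\<in>\<BB>\<^sub>0. closedin mtopology C)"

definition enlargement :: "'a set \<Rightarrow> real \<Rightarrow> 'a set" where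
  "enlargement B \<delta> = (\<Union>x\<in>B. mball x \<delta>)"

definition open_Bs_cover :: "'a set set \<Rightarrow> 'a set set \<Rightarrow> bool" where
  "open_Bs_cover \<BB> \<U> \<longleftrightarrow>
     (\<forall>U\<in>\<U>. openin mtopology U) \<and> \<Union>\<U> = M \<and> M \<notin> \<U> \<and>
     (\<forall>B\<in>\<BB>. \<exists>U\<in>\<U>. \<exists>\<delta>>0. enlargement B \<delta> \<subseteq> U)"

text \<open>The \<open>\<gamma>\<close>-condition refers to the given enumeration \<open>U\<close>, which may have repetitions;
  \<open>infinite (range U)\<close> says that the family has infinitely many distinct members.\<close>

definition gamma_Bs_cover :: "'a set set \<Rightarrow> (nat \<Rightarrow> 'a set) \<Rightarrow> bool" where
  "gamma_Bs_cover \<BB> U \<longleftrightarrow>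
     (\<forall>n. openin mtopology (U n)) \<and> \<Union>(range U) = M \<and>
     infinite (range U) \<and> M \<notin> range U \<and>
     (\<forall>B\<in>\<BB>. \<exists>n\<^sub>0. \<exists>\<delta> :: nat \<Rightarrow> real. \<forall>n\<ge>n\<^sub>0. \<delta> n > 0 \<and> enlargement B (\<delta> n) \<subseteq> U n)"

definition legal_response :: "'a set \<Rightarrow> 'a set \<Rightarrow> bool" where
  "legal_response B U \<longleftrightarrow>
     openin mtopology U \<and> U \<noteq> M \<and> (\<exists>\<delta>>0. enlargement B \<delta> \<subseteq> U)"

text \<open>A strategy of ONE maps the list of TWO's previous moves, oldest first, to ONE's next move.
  As \<open>\<BB>\<close> is nonempty, requiring \<open>\<sigma> h \<in> \<BB>\<close> also at histories \<open>h\<close> that cannot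
  arise in a play is no restriction. The predicate \<open>W\<close> is the winning condition of ONE on
  the sequence of TWO's moves.\<close>

definition ONE_winning_strategy ::
    "'a set set \<Rightarrow> ((nat \<Rightarrow> 'a set) \<Rightarrow> bool) \<Rightarrow> ('a set list \<Rightarrow> 'a set) \<Rightarrow> bool" where
  "ONE_winning_strategy \<BB> W \<sigma> \<longleftrightarrow>
     (\<forall>h. \<sigma> h \<in> \<BB>) \<and>
     (\<forall>U. (\<forall>n. legal_response (\<sigma> (map U [0..<n])) (U n)) \<longrightarrow> W U)"

definition ONE_wins_open_game :: "'a set set \<Rightarrow> bool" where
  "ONE_wins_open_game \<BB> \<longleftrightarrow>
     (\<exists>\<sigma>. ONE_winning_strategy \<BB> (\<lambda>U. open_Bs_cover \<BB> (range U)) \<sigma>)"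

definition ONE_wins_gamma_game :: "'a set set \<Rightarrow> bool" where
  "ONE_wins_gamma_game \<BB> \<longleftrightarrow>
     (\<exists>\<sigma>. ONE_winning_strategy \<BB> (gamma_Bs_cover \<BB>) \<sigma>)"

end

end

theory Submission imports Defs begin

text \<open>ONE converts a strategy for the open game into one for the \<open>\<gamma>\<close>-game by playing at each
  round the union of the finitely many answers of the old strategy to short lists of moves TWO has
  already made. Every subsequence of the resulting play is then a legal play against the old
  strategy, hence an open \<open>\<BB>\<^sup>s\<close>-cover; and a play all of whose subsequences
  are open \<open>\<BB>\<^sup>s\<close>-covers is a \<open>\<gamma>\<close>-cover.\<close>

context Metric_space
begin

lemma enlargement_mono: "A \<subseteq> B \<Longrightarrow> enlargement A \<delta> \<subseteq> enlargement B \<delta>"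
  by (auto simp: enlargement_def)

text \<open>A larger move of ONE only narrows TWO's choices. So one move of ONE can stand in for all
  the moves it contains.\<close>

lemma legal_response_antimono: "A \<subseteq> B \<Longrightarrow> legal_response B U \<Longrightarrow> legal_response A U"
  unfolding legal_response_def by (meson enlargement_mono order_trans)

lemma gamma_Bs_cover_imp_open_Bs_cover:
  assumes "gamma_Bs_cover \<BB> U"
  shows "open_Bs_cover \<BB> (range U)"
proof -
  have "\<exists>V\<in>range U. \<exists>\<delta>>0. enlargement B \<delta> \<subseteq> V" if "B \<in> \<BB>" for B
  proof -
    have "\<exists>n\<^sub>0. \<exists>\<delta> :: nat \<Rightarrow> real. \<forall>n\<ge>n\<^sub>0. \<delta> n > 0 \<and> enlargement B (\<delta> n) \<subseteq> U n"
      using assms that by (simp add: gamma_Bs_cover_def)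
    then obtain n\<^sub>0 and \<delta> :: "nat \<Rightarrow> real"
      where "\<forall>n\<ge>n\<^sub>0. \<delta> n > 0 \<and> enlargement B (\<delta> n) \<subseteq> U n"
      by (elim exE)
    then have "\<delta> n\<^sub>0 > 0 \<and> enlargement B (\<delta> n\<^sub>0) \<subseteq> U n\<^sub>0"
      by simp
    then show ?thesis
      by blast
  qed
  then show ?thesis
    using assms by (simp add: gamma_Bs_cover_def open_Bs_cover_def)
qed

text \<open>If the range were finite, or the tail condition failed for some \<open>B\<close>,
  infinitely many indices would witness it. Enumerating them gives a subsequence that contradicts
  \<open>sub\<close>.\<close>

lemma gamma_Bs_coverI_subseq:
  fixes U :: "nat \<Rightarrow> 'a set"
  assumes sub: "\<And>r :: nat \<Rightarrow> nat. strict_mono r \<Longrightarrow> open_Bs_cover \<BB> (range (U \<circ> r))"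
  shows "gamma_Bs_cover \<BB> U"
proof -
  have cover: "open_Bs_cover \<BB> (range U)"
    using sub[of id] by (simp add: strict_mono_def)
  have "infinite (range U)"
  proof
    assume "finite (range U)"
    then obtain k where "infinite {n. U n = U k}"
      using pigeonhole_infinite[of UNIV U] by auto
    then obtain r :: "nat \<Rightarrow> nat" where r: "strict_mono r" "\<And>n. U (r n) = U k"
      by (auto dest: infinite_enumerate)
    then have "range (U \<circ> r) = {U k}"
      by auto
    \<comment> \<open>A cover whose only member is \<open>U k\<close> forces \<open>U k = M\<close>,
      which an open cover of this kind excludes.\<close>
    then show False
      using sub[OF r(1)] by (auto simp: open_Bs_cover_def)
  qed
  moreover have "\<exists>n\<^sub>0. \<exists>\<delta> :: nat \<Rightarrow> real. \<forall>n\<ge>n\<^sub>0. \<delta> n > 0 \<and> enlargement B (\<delta> n) \<subseteq> U n"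
    if B: "B \<in> \<BB>" for B
  proof -
    \<comment> \<open>Along a subsequence of such bad indices no member would contain an enlargement
      of \<open>B\<close>.\<close>
    have "finite {n. \<not> (\<exists>\<delta>>0. enlargement B \<delta> \<subseteq> U n)}"
    proof (rule ccontr)
      assume "infinite {n. \<not> (\<exists>\<delta>>0. enlargement B \<delta> \<subseteq> U n)}"
      then obtain r :: "nat \<Rightarrow> nat"
        where r: "strict_mono r" "\<And>n. \<not> (\<exists>\<delta>>0. enlargement B \<delta> \<subseteq> U (r n))"
        by (auto dest: infinite_enumerate)
      then show False
        using sub[OF r(1)] B by (auto simp: open_Bs_cover_def)
    qed
    then obtain m where "\<forall>n. \<not> (\<exists>\<delta>>0. enlargement B \<delta> \<subseteq> U n) \<longrightarrow> n < m"
      by (auto simp: finite_nat_set_iff_bounded)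
    then have "\<forall>n\<ge>m. \<exists>\<delta>>0. enlargement B \<delta> \<subseteq> U n"
      using not_less by blast
    then show ?thesis
      by metis
  qed
  ultimately show ?thesis
    using cover by (simp add: gamma_Bs_cover_def open_Bs_cover_def)
qed

lemma ONE_wins_gamma_game_if_open_game:
  assumes born: "bornology_on M \<BB>" and "ONE_wins_open_game \<BB>"
  shows "ONE_wins_gamma_game \<BB>"
proof -
  obtain \<sigma> where \<sigma>: "\<And>h. \<sigma> h \<in> \<BB>"
    and win: "\<And>U. (\<And>n. legal_response (\<sigma> (map U [0..<n])) (U n)) \<Longrightarrow> open_Bs_cover \<BB> (range U)"
    using assms(2) unfolding ONE_wins_open_game_def ONE_winning_strategy_def by blast
  \<comment> \<open>\<open>L h\<close> admits repetitions and any order, not only sublists of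
    \<open>h\<close>. The length bound keeps it finite, so that \<open>\<tau> h\<close> is a finite
    union of members of \<open>\<BB>\<close>.\<close>
  define L where "L = (\<lambda>h :: 'a set list. {s. set s \<subseteq> set h \<and> length s \<le> length h})"
  define \<tau> where "\<tau> = (\<lambda>h. \<Union>(\<sigma> ` L h))"
  have "\<tau> h \<in> \<BB>" for h
  proof -
    have "finite (\<sigma> ` L h)" "\<sigma> ` L h \<subseteq> \<BB>"
      using \<sigma> by (auto simp: L_def intro: finite_lists_length_le)
    then show ?thesis
      using born unfolding bornology_on_def \<tau>_def by blast
  qed
  moreover have "gamma_Bs_cover \<BB> U"
    if legal: "\<And>n. legal_response (\<tau> (map U [0..<n])) (U n)" for U
  proof (rule gamma_Bs_coverI_subseq, rule win)
    fix r :: "nat \<Rightarrow> nat" and n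
    assume r: "strict_mono r"
    \<comment> \<open>For \<open>i < n\<close> the move \<open>U (r i)\<close> precedes round
      \<open>r n\<close>, and \<open>n \<le> r n\<close> gives the length bound.\<close>
    then have "map (U \<circ> r) [0..<n] \<in> L (map U [0..<r n])"
      using strict_mono_imp_increasing[OF r, of n] by (auto simp: L_def strict_mono_less)
    then have "\<sigma> (map (U \<circ> r) [0..<n]) \<subseteq> \<tau> (map U [0..<r n])"
      unfolding \<tau>_def by blast
    then show "legal_response (\<sigma> (map (U \<circ> r) [0..<n])) ((U \<circ> r) n)"
      using legal[of "r n"] by (simp add: legal_response_antimono)
  qed
  ultimately show ?thesis
    unfolding ONE_wins_gamma_game_def ONE_winning_strategy_def by blast
qed

text \<open>The same strategy serves: both games have the same legal moves, and only the winning
  condition is weakened.\<close>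

lemma ONE_wins_open_game_if_gamma_game:
  "ONE_wins_gamma_game \<BB> \<Longrightarrow> ONE_wins_open_game \<BB>"
  unfolding ONE_wins_gamma_game_def ONE_wins_open_game_def ONE_winning_strategy_def
  by (meson gamma_Bs_cover_imp_open_Bs_cover)

end

theorem theorem5p1:
  fixes X :: "'a set" and d :: "'a \<Rightarrow> 'a \<Rightarrow> real" and \<BB> :: "'a set set"
  assumes "Metric_space X d"
    and "infinite X"
    and "bornology_on X \<BB>"
    and "\<exists>\<BB>\<^sub>0. Metric_space.closed_bornology_base X d \<BB> \<BB>\<^sub>0"
    and "X \<notin> \<BB>"
  shows "Metric_space.ONE_wins_open_game X d \<BB> \<longleftrightarrow>
         Metric_space.ONE_wins_gamma_game X d \<BB>"
  using Metric_space.ONE_wins_gamma_game_if_open_game[OF assms(1,3)]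
    Metric_space.ONE_wins_open_game_if_gamma_game[OF assms(1)] by blast

end
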